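(* Let $A\in\mathbb{C}_{n,n}$ be a singular, non-null and non-nilpotent matrix. Then the core-EP decomposition of $A$ is unique: if both $A=A_1+A_2$ and $A=B_1+B_2$ are core-EP decompositions of $A$, then $A_1=B_1$ and $A_2=B_2$.
   Context: $\mathbb{C}_{n,n}$ is the set of $n\times n$ complex matrices, $A^\ast$ is the conjugate transpose of $A$, and $\mathrm{rk}$ is the rank. For a singular matrix $A\in\mathbb{C}_{n,n}$, the index $\mathrm{Ind}(A)$ is the smallest positive integer $k$ with $\mathrm{rk}(A^{k+1})=\mathrm{rk}(A^k)$. $\mathbb{C}_n^{\mathtt{CM}}=\{A\in\mathbb{C}_{n,n} : \mathrm{rk}(A^2)=\mathrm{rk}(A)\}$ is the set of core-invertible (equivalently, group-invertible) matrices. For $A\in\mathbb{C}_{n,n}$ with $\mathrm{Ind}(A)=k$, a core-EP decomposition of $A$ is a decomposition $A=A_1+A_2$ with $A_1,A_2\in\mathbb{C}_{n,n}$ such that (i) $A_1\in\mathbb{C}_n^{\mathtt{CM}}$; (ii) $A_2^k=0$; (iii) $A_1^\ast A_2=A_2A_1=0$. *)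

theory Defs
  imports Jordan_Normal_Form.DL_Rank Jordan_Normal_Form.Schur_Decomposition
begin

abbreviation mat_rank :: "nat \<Rightarrow> complex mat \<Rightarrow> nat" where
  "mat_rank n A \<equiv> vec_space.rank n A"

(* Intended for singular A only.  A nonsingular A gets the value 1 here, not the
   value 0 that is sometimes assigned to it.  The LEAST is attained because the ranks
   of the powers of A form a decreasing sequence of natural numbers. *)
definition mat_index :: "nat \<Rightarrow> complex mat \<Rightarrow> nat" where
  "mat_index n A = (LEAST k. 0 < k \<and> mat_rank n (A ^\<^sub>m (k + 1)) = mat_rank n (A ^\<^sub>m k))"

definition core_invertible_mats :: "nat \<Rightarrow> complex mat set" where
  "core_invertible_mats n = {A \<in> carrier_mat n n. mat_rank n (A ^\<^sub>m 2) = mat_rank n A}"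

definition nilpotent_mat :: "nat \<Rightarrow> complex mat \<Rightarrow> bool" where
  "nilpotent_mat n A \<longleftrightarrow> (\<exists>k>0. A ^\<^sub>m k = 0\<^sub>m n n)"

definition core_EP_decomposition ::
    "nat \<Rightarrow> complex mat \<Rightarrow> complex mat \<Rightarrow> complex mat \<Rightarrow> bool" where
  "core_EP_decomposition n A A1 A2 \<longleftrightarrow>
     A1 \<in> carrier_mat n n \<and> A2 \<in> carrier_mat n n \<and> A = A1 + A2 \<and>
     A1 \<in> core_invertible_mats n \<and>
     A2 ^\<^sub>m mat_index n A = 0\<^sub>m n n \<and>
     mat_adjoint A1 * A2 = 0\<^sub>m n n \<and> A2 * A1 = 0\<^sub>m n n"

end

(* Put P = A^k with k = Ind(A), and let A = A1 + A2 be a core-EP decomposition.  From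
   A2 A1 = 0 and A2^k = 0 one gets P = A1 X for some X and P A1 = A1^(k+1); as A1 is
   core-invertible, A1 = A1^(k+1) Z for some Z, so that A1 = P A1 Z.  The core parts A1, B1 of
   two decompositions thus have the same column space as P, and each is a right multiple of the
   other.  Hence D = A1 - B1 = B2 - A2 is a right multiple of A1 and of B1, so
   D^* A2 = D^* B2 = 0.  Therefore D^* D = 0 and D = 0. *)
theory Submission
  imports Defs
begin

lemma mat_adjoint_dim [simp]:
  "dim_row (mat_adjoint A) = dim_col A" "dim_col (mat_adjoint A) = dim_row A"
  by (simp_all add: mat_adjoint_def)

lemma mat_adjoint_carrier [simp]:
  "A \<in> carrier_mat n m \<Longrightarrow> mat_adjoint A \<in> carrier_mat m n"
  by (auto intro: carrier_matI)

lemma mat_adjoint_index [simp]: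
  assumes "i < dim_col A" "j < dim_row A"
  shows "mat_adjoint A $$ (i, j) = conjugate (A $$ (j, i))"
  using assms by (simp add: mat_adjoint_def mat_of_rows_index)

lemma mat_adjoint_mult:
  fixes A B :: "'a :: conjugatable_field mat"
  assumes "A \<in> carrier_mat n m" "B \<in> carrier_mat m p"
  shows "mat_adjoint (A * B) = mat_adjoint B * mat_adjoint A"
proof (rule eq_matI)
  fix i j assume "i < dim_row (mat_adjoint B * mat_adjoint A)"
    and "j < dim_col (mat_adjoint B * mat_adjoint A)"
  then have ij: "i < p" "j < n" using assms by auto
  then show "mat_adjoint (A * B) $$ (i, j) = (mat_adjoint B * mat_adjoint A) $$ (i, j)"
    using assms
    by (auto simp: scalar_prod_def sum_conjugate conjugate_dist_mul mult.commute intro!: sum.cong)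
qed (use assms in auto)

text \<open>The diagonal entries of \<open>mat_adjoint A * A\<close> are the squared norms of the
  columns of \<open>A\<close>.\<close>

lemma mat_adjoint_mult_self_eq_0:
  fixes A :: "complex mat"
  assumes A: "A \<in> carrier_mat n m" and 0: "mat_adjoint A * A = 0\<^sub>m m m"
  shows "A = 0\<^sub>m n m"
proof (rule mat_col_eqI)
  fix j assume "j < dim_col (0\<^sub>m n m :: complex mat)"
  then have j: "j < m" by simp
  have "conjugate (col A j) \<bullet> col A j = (mat_adjoint A * A) $$ (j, j)"
    using A j by (simp add: mat_adjoint_def)
  also have "\<dots> = 0"
    using 0 j by simp
  finally have "col A j \<bullet>c col A j = 0"
    using A by (metis carrier_vec_conjugate col_carrier_vec comm_scalar_prod carrier_matD(2) j)
  then show "col A j = col (0\<^sub>m n m) j"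
    using A j conjugate_square_eq_0_vec[of "col A j" n] by auto
qed (use A in auto)

text \<open>A maximal independent \<open>U\<close> in \<open>T\<close> has as many elements as the
  dimension of \<open>span T\<close>. It lies in \<open>span S\<close>, whose dimension is the same,
  so it is a basis there and \<open>span S = span U\<close> is contained in
  \<open>span T\<close>.\<close>

lemma (in vec_space) span_eq_of_dim_eq:
  assumes S: "S \<subseteq> carrier_vec n" "finite S" and T: "T \<subseteq> carrier_vec n" "finite T"
    and TS: "T \<subseteq> span S"
    and dim: "vectorspace.dim class_ring (span_vs T) = vectorspace.dim class_ring (span_vs S)"
  shows "span T = span S"
proof -
  have vsS: "vectorspace class_ring (span_vs S)"
    using S span_is_subspace subspace_is_vs by simp
  have subS: "submodule class_ring (span S) V"
    using S span_is_submodule by simp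
  obtain U where U: "maximal U (\<lambda>X. X \<subseteq> T \<and> lin_indpt X)" "finite U"
    using maximal_exists_superset[of T "\<lambda>X. X \<subseteq> T \<and> lin_indpt X" "{}"] T(2)
    by (metis (no_types, lifting) empty_subsetI finite_lin_indpt2 finite.emptyI empty_iff)
  then have UT: "U \<subseteq> T" and li: "lin_indpt U"
    by (auto simp: maximal_def)
  then have US: "U \<subseteq> span S" using TS by blast
  have "vectorspace.basis class_ring (span_vs S) U"
  proof (rule vectorspace.dim_li_is_basis[OF vsS])
    show "vectorspace.fin_dim class_ring (span_vs S)"
      using fin_dim_span S by simp
    show "U \<subseteq> carrier (span_vs S)" using US by simp
    \<comment> \<open>For subsets of the submodule \<open>span S\<close>, independence and span mean
      the same inside \<open>span_vs S\<close> as in the whole space.\<close>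
    show "LinearCombinations.module.lin_indpt class_ring (span_vs S) U"
      using span_li_not_depend(2)[OF US subS] li by simp
    show "vectorspace.dim class_ring (span_vs S) \<le> card U"
      using dim_span[OF _ T(2) U(1)] T(1) dim by simp
  qed (fact U(2))
  then have "span U = span S"
    using span_li_not_depend(1)[OF US subS] by (simp add: vectorspace.basis_def[OF vsS])
  moreover have "span U \<subseteq> span T" by (rule span_is_monotone[OF UT])
  moreover have "span T \<subseteq> span S"
    using span_is_subset[OF TS subS] by simp
  ultimately show ?thesis by blast
qed

text \<open>The column space of \<open>A * B\<close> lies in that of \<open>A\<close>, and equal
  ranks make the two equal. So each column of \<open>A\<close> is the image of some vector under
  \<open>A * B\<close>; these vectors are the columns of \<open>Z\<close>.\<close>

lemma (in vec_space) mult_rank_eq_imp_factor: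
  assumes A: "A \<in> carrier_mat n m" and B: "B \<in> carrier_mat m p"
    and rank: "rank (A * B) = rank A"
  shows "\<exists>Z \<in> carrier_mat p m. A = A * B * Z"
proof -
  have AB: "A * B \<in> carrier_mat n p" using A B by simp
  have "set (cols (A * B)) \<subseteq> col_space A"
  proof
    fix v assume "v \<in> set (cols (A * B))"
    then obtain j where j: "j < p" "v = col (A * B) j"
      using AB by (auto simp: cols_def)
    then have "v = A *\<^sub>v col B j" using A B by (auto simp: col_mult2)
    then show "v \<in> col_space A"
      using A B j by (auto simp: col_space_eq[OF A])
  qed
  then have eq: "col_space (A * B) = col_space A"
    using span_eq_of_dim_eq[of "set (cols A)" "set (cols (A * B))"] rank A AB
      cols_dim[of A] cols_dim[of "A * B"]
    by (auto simp: rank_def col_space_def)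
  have "\<exists>x \<in> carrier_vec p. A * B *\<^sub>v x = col A j" if "j < m" for j
  proof -
    have "col A j \<in> col_space A"
      unfolding col_space_def using A that cols_dim[of A]
      by (intro subsetD[OF in_own_span]) (auto simp: cols_def)
    then show ?thesis
      unfolding eq[symmetric] col_space_eq[OF AB] using B by auto
  qed
  then obtain x where x: "\<And>j. j < m \<Longrightarrow> x j \<in> carrier_vec p"
    "\<And>j. j < m \<Longrightarrow> A * B *\<^sub>v x j = col A j"
    by metis
  define Z where "Z = mat_of_cols p (map x [0..<m])"
  have Z: "Z \<in> carrier_mat p m" unfolding Z_def by auto
  moreover have "A = A * B * Z"
  proof (rule mat_col_eqI)
    fix j assume "j < dim_col (A * B * Z)"
    then have j: "j < m" using Z by simp
    then have "col Z j = x j" unfolding Z_def using x(1) by simp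
    then show "col A j = col (A * B * Z) j"
      using col_mult2[OF AB Z j] x(2)[OF j] by simp
  qed (use A AB Z in auto)
  ultimately show ?thesis by blast
qed

text \<open>Equal ranks of \<open>A * A\<close> and \<open>A\<close> give
  \<open>A = A * A * Y\<close>, and substituting this for a factor \<open>A\<close> raises the
  exponent by one each time.\<close>

lemma core_invertible_factor_pow:
  assumes "A \<in> core_invertible_mats n"
  shows "\<exists>Z \<in> carrier_mat n n. A = A ^\<^sub>m Suc k * Z"
proof -
  interpret vec_space "TYPE(complex)" n .
  have A: "A \<in> carrier_mat n n" and "rank (A * A) = rank A"
    using assms by (auto simp: core_invertible_mats_def numeral_2_eq_2)
  then obtain Y where Y: "Y \<in> carrier_mat n n" "A = A * A * Y"
    using mult_rank_eq_imp_factor by blast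
  show ?thesis
  proof (induction k)
    case 0
    then show ?case using A by (intro bexI[of _ "1\<^sub>m n"]) auto
  next
    case (Suc k)
    then obtain Z where Z: "Z \<in> carrier_mat n n" "A = A ^\<^sub>m Suc k * Z" by blast
    have P: "A ^\<^sub>m k \<in> carrier_mat n n" using A by simp
    \<comment> \<open>Only the last factor of \<open>A ^\<^sub>m Suc k\<close> is replaced.\<close>
    have "A = A ^\<^sub>m k * (A * A * Y) * Z"
      using Z(2) Y(2) by simp
    also have "\<dots> = A ^\<^sub>m Suc (Suc k) * (Y * Z)"
      using A P Y(1) Z(1) by (simp add: assoc_mult_mat[of _ n n _ n _ n])
    finally show ?case using Y(1) Z(1) by (meson mult_carrier_mat)
  qed
qed

text \<open>Since \<open>(A + B) * A = A * A\<close>, each factor \<open>A + B\<close> acts on a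
  power of \<open>A\<close> as \<open>A\<close> does.\<close>

lemma pow_add_mult_eq_pow_Suc:
  fixes A B :: "'a :: semiring_1 mat"
  assumes A: "A \<in> carrier_mat n n" and B: "B \<in> carrier_mat n n" and BA: "B * A = 0\<^sub>m n n"
  shows "(A + B) ^\<^sub>m k * A = A ^\<^sub>m Suc k"
proof (induction k)
  case 0
  then show ?case using A B by simp
next
  case (Suc k)
  have AB: "A + B \<in> carrier_mat n n" using A B by simp
  have "(A + B) ^\<^sub>m Suc k * A = (A + B) ^\<^sub>m k * ((A + B) * A)"
    using A AB by (simp add: assoc_mult_mat[of _ n n _ n _ n])
  also have "(A + B) * A = A * A"
    using A B BA by (simp add: add_mult_distrib_mat[of _ n n])
  also have "(A + B) ^\<^sub>m k * (A * A) = (A + B) ^\<^sub>m k * A * A"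
    using A AB by (simp add: assoc_mult_mat[of _ n n _ n _ n])
  finally show ?case using Suc.IH by simp
qed

text \<open>Expand the power into words in \<open>A\<close> and \<open>B\<close>. A word starting
  with \<open>B\<close> is either a pure power of \<open>B\<close> or contains \<open>B * A\<close>
  and vanishes; all others have a factor \<open>A\<close> in front.\<close>

lemma pow_add_eq_mult_add_pow:
  fixes A B :: "'a :: semiring_1 mat"
  assumes A: "A \<in> carrier_mat n n" and B: "B \<in> carrier_mat n n" and BA: "B * A = 0\<^sub>m n n"
  shows "\<exists>X \<in> carrier_mat n n. (A + B) ^\<^sub>m k = A * X + B ^\<^sub>m k"
proof (induction k)
  case 0
  then show ?case using A B by (intro bexI[of _ "0\<^sub>m n n"]) auto
next
  case (Suc k)
  then obtain X where X: "X \<in> carrier_mat n n" "(A + B) ^\<^sub>m k = A * X + B ^\<^sub>m k" by blast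
  let ?M = "A * X + B ^\<^sub>m k"
  have AB: "A + B \<in> carrier_mat n n" and Bk: "B ^\<^sub>m k \<in> carrier_mat n n"
    using A B by simp_all
  \<comment> \<open>\<open>^\<^sub>m\<close> appends factors on the right, but the new factor
    \<open>A + B\<close> must come from the left to keep \<open>A\<close> in front.\<close>
  have left: "C ^\<^sub>m Suc k = C * C ^\<^sub>m k" if "C \<in> carrier_mat n n" for C :: "'a mat"
    using that by (induction k) (simp_all add: assoc_mult_mat[of _ n n _ n _ n])
  have "B * ?M = (B * A) * X + B * B ^\<^sub>m k"
    using A B X(1) Bk
    by (simp add: mult_add_distrib_mat[of _ n n _ n] assoc_mult_mat[of _ n n _ n _ n])
  also have "\<dots> = B ^\<^sub>m Suc k"
    using B X(1) Bk BA unfolding left[OF B] by simp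
  \<comment> \<open>The witness for the next exponent is \<open>?M\<close>, which is
    \<open>(A + B) ^\<^sub>m k\<close> itself.\<close>
  finally have "(A + B) ^\<^sub>m Suc k = A * ?M + B ^\<^sub>m Suc k"
    using add_mult_distrib_mat[OF A B, of ?M n] A X(1) Bk unfolding left[OF AB] X(2) by simp
  moreover have "?M \<in> carrier_mat n n" using A X(1) Bk by simp
  ultimately show ?case by blast
qed

text \<open>\<open>P\<close> depends on \<open>A\<close> alone, so it links any two decompositions
  of \<open>A\<close>.\<close>

lemma core_EP_decomposition_factors:
  assumes "core_EP_decomposition n A A1 A2"
  defines "P \<equiv> A ^\<^sub>m mat_index n A"
  shows "\<exists>X \<in> carrier_mat n n. P = A1 * X" "\<exists>W \<in> carrier_mat n n. A1 = P * W"
proof -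
  have A1: "A1 \<in> carrier_mat n n" and A2: "A2 \<in> carrier_mat n n" and A: "A = A1 + A2"
    and core: "A1 \<in> core_invertible_mats n" and nil: "A2 ^\<^sub>m mat_index n A = 0\<^sub>m n n"
    and A21: "A2 * A1 = 0\<^sub>m n n"
    using assms by (auto simp: core_EP_decomposition_def)
  obtain X where X: "X \<in> carrier_mat n n" "P = A1 * X + A2 ^\<^sub>m mat_index n A"
    using pow_add_eq_mult_add_pow[OF A1 A2 A21] unfolding P_def A by blast
  then show "\<exists>X \<in> carrier_mat n n. P = A1 * X"
    using A1 nil by auto
  \<comment> \<open>The exponent exceeds the index by one because it is \<open>P * A1\<close>, not
    \<open>P\<close>, that is known to be a power of \<open>A1\<close>.\<close>
  obtain Z where Z: "Z \<in> carrier_mat n n" "A1 = A1 ^\<^sub>m Suc (mat_index n A) * Z"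
    using core_invertible_factor_pow[OF core] by blast
  have "A1 ^\<^sub>m Suc (mat_index n A) = P * A1"
    using pow_add_mult_eq_pow_Suc[OF A1 A2 A21] unfolding P_def A by simp
  then have "A1 = P * (A1 * Z)"
    using Z A1 A2 A by (simp add: P_def assoc_mult_mat[of _ n n _ n _ n])
  then show "\<exists>W \<in> carrier_mat n n. A1 = P * W"
    using A1 Z(1) by (meson mult_carrier_mat)
qed

text \<open>With \<open>P\<close> the common power of \<open>A\<close>, one has
  \<open>A1 = P * W\<close> and \<open>P = B1 * X\<close>, hence \<open>Y = X * W\<close>.\<close>

lemma core_EP_decomposition_core_factor:
  assumes "core_EP_decomposition n A A1 A2" "core_EP_decomposition n A B1 B2"
  shows "\<exists>Y \<in> carrier_mat n n. A1 = B1 * Y"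
proof -
  obtain X W where "X \<in> carrier_mat n n" "A ^\<^sub>m mat_index n A = B1 * X"
    and "W \<in> carrier_mat n n" "A1 = A ^\<^sub>m mat_index n A * W"
    using core_EP_decomposition_factors assms by meson
  moreover have "B1 \<in> carrier_mat n n"
    using assms by (simp add: core_EP_decomposition_def)
  ultimately have "A1 = B1 * (X * W)" "X * W \<in> carrier_mat n n" by auto
  then show ?thesis by blast
qed

text \<open>The product regroups as \<open>mat_adjoint Y * (mat_adjoint B * C)\<close>: what is
  orthogonal to the columns of \<open>B\<close> is orthogonal to all their combinations.\<close>

lemma adjoint_mult_right_mult_eq_0:
  fixes B C Y :: "complex mat"
  assumes "B \<in> carrier_mat n n" "Y \<in> carrier_mat n n" "C \<in> carrier_mat n n"
    and "mat_adjoint B * C = 0\<^sub>m n n"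
  shows "mat_adjoint (B * Y) * C = 0\<^sub>m n n"
  using assms by (simp add: mat_adjoint_mult[of _ n n _ n] assoc_mult_mat[of _ n n _ n _ n])

theorem theorem2p2:
  fixes n :: nat and A A1 A2 B1 B2 :: "complex mat"
  assumes "A \<in> carrier_mat n n"
    and "\<not> invertible_mat A"
    and "A \<noteq> 0\<^sub>m n n"
    and "\<not> nilpotent_mat n A"
    and "core_EP_decomposition n A A1 A2"
    and "core_EP_decomposition n A B1 B2"
  shows "A1 = B1 \<and> A2 = B2"
proof -
  have A1: "A1 \<in> carrier_mat n n" and A2: "A2 \<in> carrier_mat n n"
    and B1: "B1 \<in> carrier_mat n n" and B2: "B2 \<in> carrier_mat n n"
    and eq: "A1 + A2 = B1 + B2"
    and A12: "mat_adjoint A1 * A2 = 0\<^sub>m n n" and B12: "mat_adjoint B1 * B2 = 0\<^sub>m n n"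
    using assms(5,6) by (auto simp: core_EP_decomposition_def)
  obtain Y where Y: "Y \<in> carrier_mat n n" "A1 = B1 * Y"
    using core_EP_decomposition_core_factor[OF assms(5,6)] by blast
  obtain Z where Z: "Z \<in> carrier_mat n n" "B1 = A1 * Z"
    using core_EP_decomposition_core_factor[OF assms(6,5)] by blast
  define D where "D = A1 - B1"
  have D: "D \<in> carrier_mat n n" using B1 by (auto simp: D_def)
  \<comment> \<open>Cancellation is carried out on complex entries, both for the second form of
    \<open>D\<close> and for \<open>A2 = B2\<close> at the end.\<close>
  have entries: "A1 $$ (i, j) + A2 $$ (i, j) = B1 $$ (i, j) + B2 $$ (i, j)"
    if "i < n" "j < n" for i j
    using arg_cong[OF eq, of "\<lambda>M. M $$ (i, j)"] A1 A2 B1 B2 that by simp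
  have D2: "D = B2 - A2"
    using A1 A2 B1 B2 entries by (intro eq_matI) (auto simp: D_def algebra_simps)
  \<comment> \<open>Replacing \<open>B1\<close> by \<open>A1 * Z\<close> makes \<open>D\<close>
    inherit the orthogonality of \<open>A1\<close> to \<open>A2\<close>; below,
    \<open>A1 = B1 * Y\<close> does the same for \<open>B1\<close> and \<open>B2\<close>.\<close>
  have "D = A1 * (1\<^sub>m n - Z)"
    unfolding D_def using A1 Z(1) by (subst Z(2)) (simp add: mult_minus_distrib_mat[of _ n n _ n])
  then have DA: "mat_adjoint D * A2 = 0\<^sub>m n n"
    using adjoint_mult_right_mult_eq_0[OF A1 _ A2 A12] Z(1) by (simp add: minus_carrier_mat)
  have "D = B1 * (Y - 1\<^sub>m n)"
    unfolding D_def using B1 Y(1) by (subst Y(2)) (simp add: mult_minus_distrib_mat[of _ n n _ n])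
  then have DB: "mat_adjoint D * B2 = 0\<^sub>m n n"
    using adjoint_mult_right_mult_eq_0[OF B1 _ B2 B12] Y(1) by (simp add: minus_carrier_mat)
  \<comment> \<open>Only the right factor is rewritten as \<open>B2 - A2\<close>; both resulting
    terms vanish.\<close>
  have "mat_adjoint D * D = mat_adjoint D * B2 - mat_adjoint D * A2"
    using mult_minus_distrib_mat[of "mat_adjoint D" n n B2 n A2] D A2 B2 by (simp flip: D2)
  then have "D = 0\<^sub>m n n"
    using mat_adjoint_mult_self_eq_0[OF D] DA DB by simp
  then have "D $$ (i, j) = 0" if "i < n" "j < n" for i j
    using that by simp
  then have "A1 $$ (i, j) = B1 $$ (i, j)" if "i < n" "j < n" for i j
    using that B1 A1 by (simp add: D_def)
  then have "A1 = B1"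
    using A1 B1 by (intro eq_matI) auto
  moreover from this have "A2 = B2"
    using A2 B2 entries by (intro eq_matI) auto
  ultimately show ?thesis by simp
qed

end
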